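(* Let $r\ge2$ be an integer, let $\ell$ be a prime with $r\mid\ell-1$, and let $N$ be an integer with $\gcd(N,\ell)=1$. Then $|P_r(N;\ell)|=(\ell-1)/r$. Moreover, if $N=u^rv$ with $u,v\in\mathbb F_\ell^*$, then $(u^r\bmod\ell,\ v\bmod\ell)\in P_r(N;\ell)$.
   Context: $(\mathbb F_\ell^* )^r=\{t^r:t\in\mathbb F_\ell^*\}$, and $P_r(N;\ell)=\{(x,y)\in\mathbb F_\ell^*\times\mathbb F_\ell^*: xy\equiv N\pmod\ell,\ x\in(\mathbb F_\ell^* )^r\}$. *)

theory Defs
  imports "HOL-Number_Theory.Residues"
begin

(* The field F_l is residue_ring (int l), whose elements are the integers
   0, ..., l - 1; for prime l its units are 1, ..., l - 1. *)

definition Fstar :: "nat \<Rightarrow> int set" where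
  "Fstar l = Units (residue_ring (int l))"

definition Fstar_powers :: "nat \<Rightarrow> nat \<Rightarrow> int set" where
  "Fstar_powers r l = {t [^]\<^bsub>residue_ring (int l)\<^esub> r | t. t \<in> Fstar l}"

definition P_r :: "nat \<Rightarrow> int \<Rightarrow> nat \<Rightarrow> (int \<times> int) set" where
  "P_r r N l = {(x, y) \<in> Fstar l \<times> Fstar l. [x * y = N] (mod int l) \<and> x \<in> Fstar_powers r l}"

end

theory Submission
  imports Defs "HOL-Number_Theory.Residue_Primitive_Roots"
begin

text \<open>
  Since \<open>N\<close> is a unit modulo \<open>\<ell>\<close>, each unit \<open>x\<close> has exactly one partner \<open>y\<close> with
  \<open>x y \<equiv> N\<close>, namely \<open>x\<^sup>-\<^sup>1 N\<close>. Hence the first projection identifies \<open>P\<^sub>r(N; \<ell>)\<close> with the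
  group of \<open>r\<close>-th powers, and the count reduces to the index of that subgroup
  (\<open>bij_betw_fst_P_r\<close>).
  The unit group is cyclic of order \<open>\<ell> - 1\<close>; with a generator \<open>g\<close> the \<open>r\<close>-th powers are the
  \<open>g\<^bsup>r j\<^esup>\<close>, and as \<open>r\<close> divides \<open>\<ell> - 1\<close>, the exponent \<open>j\<close> matters precisely modulo
  \<open>(\<ell> - 1) / r\<close> (\<open>card_Fstar_powers\<close>).
  The second claim is a direct verification: the reductions of \<open>u\<^sup>r\<close> and \<open>v\<close> multiply to \<open>N\<close>.
\<close>

lemma Fstar_prime:
  assumes "prime l"
  shows "Fstar l = {0<..<int l}"
proof -
  have "Fstar l = {1..int (l - 1)}"
    unfolding Fstar_def by (rule residues_prime.res_prime_units_eq) (unfold_locales, fact assms)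
  also have "\<dots> = {0<..<int l}"
    using prime_gt_1_nat[OF assms] by auto
  finally show ?thesis .
qed

lemma mod_in_Fstar:
  assumes "prime l" "coprime a (int l)"
  shows "a mod int l \<in> Fstar l"
proof -
  interpret residues_prime l "residue_ring (int l)"
    using assms(1) by unfold_locales
  show ?thesis
    unfolding Fstar_def using assms(2) m_gt_one by (rule mod_in_res_units[rotated])
qed

lemma Fstar_coprime:
  assumes "prime l" "x \<in> Fstar l"
  shows "coprime x (int l)"
proof -
  interpret residues_prime l "residue_ring (int l)"
    using assms(1) by unfold_locales
  show ?thesis
    using assms(2) by (simp add: Fstar_def res_units_eq)
qed

lemma Fstar_mod_eq: "prime l \<Longrightarrow> x \<in> Fstar l \<Longrightarrow> x mod int l = x"
  by (simp add: Fstar_prime)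

lemma Fstar_powers_prime:
  assumes "prime l"
  shows "Fstar_powers r l = (\<lambda>t. t ^ r mod int l) ` Fstar l"
proof -
  interpret residues_prime l "residue_ring (int l)"
    using assms by unfold_locales
  have "t [^]\<^bsub>residue_ring (int l)\<^esub> r = t ^ r mod int l" if "t \<in> Fstar l" for t
    using pow_cong[of t r] Fstar_mod_eq[OF assms that] by simp
  then show ?thesis
    unfolding Fstar_powers_def Setcompr_eq_image Collect_mem_eq by (rule image_cong[OF refl])
qed

lemma Fstar_powers_subset:
  assumes "prime l"
  shows "Fstar_powers r l \<subseteq> Fstar l"
  using assms by (auto simp: Fstar_powers_prime Fstar_coprime intro!: mod_in_Fstar)

lemma Fstar_eq_primroot_powers:
  assumes "prime l" "residue_primroot l g"
  shows "Fstar l = (\<lambda>i. int (g ^ i mod l)) ` {..<l - 1}"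
proof -
  have "Fstar l = int ` totatives l"
  proof -
    have "x \<in> int ` {0<..<l}" if "0 < x" "x < int l" for x
      using that by (intro image_eqI[of _ _ "nat x"]) auto
    then show ?thesis
      using assms(1) by (auto simp: Fstar_prime totatives_prime)
  qed
  also have "totatives l = (\<lambda>i. g ^ i mod l) ` {..<l - 1}"
    using residue_primroot_is_generator[OF prime_gt_1_nat[OF assms(1)] assms(2)] assms(1)
    by (simp add: bij_betw_def totient_prime)
  finally show ?thesis
    by (simp add: image_image)
qed

text \<open>
  Parametrising by exponents of a primitive root turns \<open>r\<close>-th powers into multiples of \<open>r\<close>
  modulo \<open>l - 1 = r k\<close>, and there are \<open>k\<close> of those.
\<close>
lemma card_Fstar_powers:
  assumes "prime l" "r dvd l - 1"
  shows "card (Fstar_powers r l) = (l - 1) div r"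
proof -
  obtain k where k: "l - 1 = r * k"
    using assms(2) by blast
  have "r > 0" "k > 0"
    using k prime_gt_1_nat[OF assms(1)] by (auto intro!: Nat.gr0I)
  obtain g where g: "residue_primroot l g"
    using prime_primitive_root_exists[OF prime_gt_1_nat assms(1)] assms(1) by blast
  define f where "f = (\<lambda>j. int (g ^ (r * j) mod l))"
  have f_eq_iff: "f i = f j \<longleftrightarrow> [i = j] (mod k)" for i j
  proof -
    have "f i = f j \<longleftrightarrow> [g ^ (r * i) = g ^ (r * j)] (mod l)"
      by (simp add: f_def cong_def)
    also have "\<dots> \<longleftrightarrow> [r * i = r * j] (mod l - 1)"
      using g assms(1) order_divides_expdiff[of l g]
      by (simp add: residue_primroot_def totient_prime)
    also have "\<dots> \<longleftrightarrow> [i = j] (mod k)"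
      unfolding k cong_def mult_mod_right[symmetric] using \<open>r > 0\<close> by simp
    finally show ?thesis .
  qed
  have "int (g ^ i mod l) ^ r mod int l = f i" for i
  proof -
    have "int (g ^ i mod l) ^ r mod int l = int ((g ^ i mod l) ^ r mod l)"
      by (simp only: of_nat_power of_nat_mod)
    also have "(g ^ i mod l) ^ r mod l = g ^ (r * i) mod l"
      by (simp only: power_mod power_mult[symmetric] mult.commute)
    finally show ?thesis
      by (simp only: f_def)
  qed
  then have "Fstar_powers r l = f ` {..<l - 1}"
    by (simp only: Fstar_powers_prime[OF assms(1)] Fstar_eq_primroot_powers[OF assms(1) g]
        image_image)
  also have "\<dots> = f ` {..<k}"
  proof
    show "f ` {..<l - 1} \<subseteq> f ` {..<k}"
    proof
      fix x assume "x \<in> f ` {..<l - 1}"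
      then obtain i where "x = f i" by blast
      also have "f i = f (i mod k)"
        by (simp add: f_eq_iff cong_def)
      finally show "x \<in> f ` {..<k}"
        using \<open>k > 0\<close> by simp
    qed
    show "f ` {..<k} \<subseteq> f ` {..<l - 1}"
      unfolding k using \<open>r > 0\<close> by (intro image_mono) simp
  qed
  also have "card \<dots> = k"
    by (subst card_image) (auto simp: inj_on_def f_eq_iff cong_def)
  finally show ?thesis
    using k \<open>r > 0\<close> by simp
qed

text \<open>
  The second coordinate can be cancelled down to \<open>x\<^sup>-\<^sup>1 N\<close>, so it is determined by \<open>x\<close>; this value is
  again a unit because \<open>N\<close> is one, so every \<open>r\<close>-th power occurs as a first coordinate.
\<close>
lemma bij_betw_fst_P_r:
  assumes "prime l" "coprime N (int l)"
  shows "bij_betw fst (P_r r N l) (Fstar_powers r l)"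
  unfolding bij_betw_def
proof (intro conjI)
  show "inj_on fst (P_r r N l)"
  proof (rule inj_onI)
    fix p q assume p: "p \<in> P_r r N l" and q: "q \<in> P_r r N l" and "fst p = fst q"
    then obtain x y z where pq: "p = (x, y)" "q = (x, z)"
      by (metis prod.collapse)
    have mem: "x \<in> Fstar l" "y \<in> Fstar l" "z \<in> Fstar l" and "[x * y = x * z] (mod int l)"
      using p q by (auto simp: pq P_r_def intro: cong_trans cong_sym)
    then have "[y = z] (mod int l)"
      using cong_mult_lcancel[OF Fstar_coprime[OF assms(1)]] by blast
    then show "p = q"
      using mem by (simp add: pq cong_def Fstar_mod_eq[OF assms(1)])
  qed
  show "fst ` P_r r N l = Fstar_powers r l"
  proof
    show "fst ` P_r r N l \<subseteq> Fstar_powers r l"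
      by (auto simp: P_r_def)
    show "Fstar_powers r l \<subseteq> fst ` P_r r N l"
    proof
      fix x assume x: "x \<in> Fstar_powers r l"
      then have xF: "x \<in> Fstar l"
        using Fstar_powers_subset[OF assms(1)] by blast
      obtain w where w: "[x * w = 1] (mod int l)"
        using cong_solve_coprime_int[OF Fstar_coprime[OF assms(1) xF]] by blast
      have "coprime w (int l)"
        using w coprime_iff_invertible_int[of w "int l"] by (auto simp: mult.commute)
      then have "w * N mod int l \<in> Fstar l"
        using assms by (intro mod_in_Fstar) auto
      moreover have "[x * (w * N mod int l) = N] (mod int l)"
        using cong_scalar_right[OF w, of N] by (simp add: cong_def mod_mult_right_eq mult.assoc)
      ultimately have "(x, w * N mod int l) \<in> P_r r N l"
        using x xF by (simp add: P_r_def)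
      then show "x \<in> fst ` P_r r N l"
        by force
    qed
  qed
qed

theorem proposition9p2:
  fixes r l :: nat and N :: int
  assumes "r \<ge> 2" and "prime l" and "r dvd l - 1" and "gcd N (int l) = 1"
  shows "card (P_r r N l) = (l - 1) div r \<and>
    (\<forall>u \<in> Fstar l. \<forall>v \<in> Fstar l.
       [N = u ^ r * v] (mod int l) \<longrightarrow> (u ^ r mod int l, v mod int l) \<in> P_r r N l)"
proof (intro conjI ballI impI)
  have "coprime N (int l)"
    using assms(4) by (simp add: coprime_iff_gcd_eq_1)
  then show "card (P_r r N l) = (l - 1) div r"
    using bij_betw_same_card[OF bij_betw_fst_P_r] card_Fstar_powers assms(2,3) by metis
next
  fix u v assume uv: "u \<in> Fstar l" "v \<in> Fstar l" and "[N = u ^ r * v] (mod int l)"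
  then have "[u ^ r mod int l * (v mod int l) = N] (mod int l)"
    by (simp add: cong_def mod_mult_eq)
  moreover have "u ^ r mod int l \<in> Fstar_powers r l"
    using uv(1) Fstar_powers_prime[OF assms(2)] by blast
  ultimately show "(u ^ r mod int l, v mod int l) \<in> P_r r N l"
    using uv(2) Fstar_powers_subset[OF assms(2)] Fstar_mod_eq[OF assms(2)]
    by (auto simp: P_r_def)
qed

end
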